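(* Let $p\in\{103,157,193\}$. Then for all integers $n\ge 0$ and $k\ge 0$ with $p\nmid(3n+1)$, $$B_5\left(p^{2k+1}n+\frac{p^{2k+1}-1}{3}\right)\equiv 0\pmod 5.$$
   Context: A partition is called $5$-regular if none of its parts is divisible by $5$. $B_5(n)$ denotes the number of ordered pairs $(\lambda,\mu)$ of $5$-regular partitions such that the sum of all parts of $\lambda$ and $\mu$ equals $n$ (so $B_5(0)=1$); equivalently $\sum_{n\ge 0}B_5(n)q^n=\prod_{k\ge1}\frac{(1-q^{5k})^2}{(1-q^k)^2}$. *)

theory Defs
  imports "HOL-Library.Multiset" "HOL-Number_Theory.Cong"
begin

(* A partition is the multiset of its parts, which are positive integers;
   the empty multiset is the partition of 0. *)
definition is_partition :: "nat multiset \<Rightarrow> bool" where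
  "is_partition M \<longleftrightarrow> (\<forall>x\<in>#M. x > 0)"

definition regular_partition :: "nat \<Rightarrow> nat multiset \<Rightarrow> bool" where
  "regular_partition l M \<longleftrightarrow> is_partition M \<and> (\<forall>x\<in>#M. \<not> l dvd x)"

definition bipartitions5 :: "nat \<Rightarrow> (nat multiset \<times> nat multiset) set" where
  "bipartitions5 n =
     {(M, N). regular_partition 5 M \<and> regular_partition 5 N \<and> sum_mset M + sum_mset N = n}"

definition B5 :: "nat \<Rightarrow> nat" where
  "B5 n = card (bipartitions5 n)"

(* Finiteness ensures that the cardinality above is a genuine count. *)
lemma finite_partitions_le: "finite {M. is_partition M \<and> sum_mset M \<le> n}"
proof (rule finite_subset)
  show "{M. is_partition M \<and> sum_mset M \<le> n} \<subseteq> mset ` {xs. set xs \<subseteq> {..n} \<and> length xs \<le> n}"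
  proof
    fix M :: "nat multiset" assume "M \<in> {M. is_partition M \<and> sum_mset M \<le> n}"
    then have pos: "\<forall>x\<in>#M. x > 0" and le: "sum_mset M \<le> n"
      by (auto simp: is_partition_def)
    obtain xs where xs: "M = mset xs" using ex_mset[of M] by auto
    have len: "length xs \<le> sum_list xs"
      using pos unfolding xs by (induction xs) auto
    have elem: "x \<le> sum_list xs" if "x \<in> set xs" for x
      using that by (induction xs) auto
    have le': "sum_list xs \<le> n"
      using le by (simp only: xs sum_mset_sum_list)
    have "set xs \<subseteq> {..n}"
      using order_trans[OF elem le'] by (auto simp only: atMost_iff)
    moreover have "length xs \<le> n"
      by (rule order_trans[OF len le'])
    ultimately show "M \<in> mset ` {xs. set xs \<subseteq> {..n} \<and> length xs \<le> n}"
      using xs by blast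
  qed
  show "finite (mset ` {xs. set xs \<subseteq> {..n} \<and> length xs \<le> n})"
    by (rule finite_imageI, rule finite_lists_length_le, rule finite_atMost)
qed

lemma finite_bipartitions5: "finite (bipartitions5 n)"
proof (rule finite_subset)
  let ?P = "{M. is_partition M \<and> sum_mset M \<le> n}"
  show "bipartitions5 n \<subseteq> ?P \<times> ?P"
  proof
    fix z assume "z \<in> bipartitions5 n"
    then obtain M N where z: "z = (M, N)"
      and M: "is_partition M" and N: "is_partition N" and sum: "sum_mset M + sum_mset N = n"
      unfolding bipartitions5_def regular_partition_def by blast
    from sum have "sum_mset M \<le> n" and "sum_mset N \<le> n"
      by linarith+
    with z M N show "z \<in> ?P \<times> ?P"
      by blast
  qed
  show "finite (?P \<times> ?P)"
    by (intro finite_cartesian_product finite_partitions_le)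
qed

end

theory Submission
  imports Defs "HOL-Number_Theory.Residues"
    "HOL-Computational_Algebra.Polynomial" "HOL-Computational_Algebra.Formal_Power_Series"
begin

text \<open>
  Write \<open>f\<^sub>d = \<Prod>k\<ge>1. (1 - q^(d k))\<close>. Since \<open>f\<^sub>5\<close> and \<open>f\<^sub>1^5\<close> agree modulo 5, so do the generating function
  \<open>(f\<^sub>5 / f\<^sub>1)^2\<close> of \<open>B5\<close> and \<open>f\<^sub>5 f\<^sub>1^3\<close>. By Euler's pentagonal number theorem a monomial \<open>q^i\<close>
  of \<open>f\<^sub>5\<close> satisfies \<open>24 i + 5 = 5 y^2\<close>, and by Jacobi's identity a monomial \<open>q^j\<close> of \<open>f\<^sub>1^3\<close> satisfies
  \<open>8 j + 1 = z^2\<close>. Hence \<open>B5 N\<close> is divisible by 5 unless \<open>8 (3 N + 1) = 5 y^2 + 3 z^2\<close>.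
  The primes 103, 157, 193 are inert in \<open>\<rat>(\<surd>-15)\<close>, so they divide the value of this form to an even power,
  whereas they divide \<open>3 N + 1 = p^(2k+1) (3 n + 1)\<close> to an odd one.

  Infinite products are avoided: \<open>f\<^sub>1\<close> is replaced by its first \<open>m\<close> factors, which determine the
  coefficients up to \<open>q^m\<close>, and Euler's and Jacobi's identities by finite versions of them.
\<close>

section \<open>Finite products and pentagonal numbers\<close>

definition qpoch :: "'a::comm_ring_1 \<Rightarrow> nat \<Rightarrow> 'a" where
  "qpoch q n = (\<Prod>i<n. 1 - q ^ Suc i)"

lemma qpoch_0 [simp]: "qpoch q 0 = 1"
  by (simp add: qpoch_def)

lemma qpoch_Suc: "qpoch q (Suc n) = qpoch q n * (1 - q ^ Suc n)"
  by (simp add: qpoch_def)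

lemma qpoch_eq_prod: "qpoch q n = (\<Prod>a\<in>{1..n}. 1 - q ^ a)"
  unfolding qpoch_def
  by (rule prod.reindex_bij_witness[of _ "\<lambda>a. a - 1" Suc]) auto

text \<open>For \<open>k \<le> n\<close> this is \<open>qpoch q n\<close> divided by
  \<open>qpoch q k\<close>, written so that it makes sense in any commutative ring.\<close>

definition qpoch_ratio :: "'a::comm_ring_1 \<Rightarrow> nat \<Rightarrow> nat \<Rightarrow> 'a" where
  "qpoch_ratio q k n = (\<Prod>i\<in>{k..<n}. 1 - q ^ Suc i)"

lemma qpoch_ratio_0: "qpoch_ratio q 0 n = qpoch q n"
  by (simp add: qpoch_def qpoch_ratio_def lessThan_atLeast0)

lemma qpoch_ratio_self [simp]: "qpoch_ratio q n n = 1"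
  by (simp add: qpoch_ratio_def)

lemma qpoch_ratio_Suc_right:
  "k \<le> n \<Longrightarrow> qpoch_ratio q k (Suc n) = qpoch_ratio q k n * (1 - q ^ Suc n)"
  by (simp add: qpoch_ratio_def)

lemma qpoch_ratio_Suc_left:
  "k < n \<Longrightarrow> qpoch_ratio q k n = (1 - q ^ Suc k) * qpoch_ratio q (Suc k) n"
  by (simp add: qpoch_ratio_def prod.atLeast_Suc_lessThan)

fun tri :: "nat \<Rightarrow> nat" where
  "tri 0 = 0"
| "tri (Suc n) = tri n + Suc n"

lemma tri_eq: "2 * tri n = n * (n + 1)"
  by (induction n) auto

text \<open>A finite form of Euler's theorem: for \<open>q = X\<close> the summands with
  \<open>k \<ge> 1\<close> on the left have order above \<open>n\<close>, and the exponents on the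
  right are the pentagonal numbers \<open>k(3k-1)/2\<close> and \<open>k(3k+1)/2\<close>.\<close>

lemma shanks_pentagonal:
  fixes q :: "'a::comm_ring_1"
  shows "(\<Sum>k\<le>n. (-1) ^ k * qpoch_ratio q k n * q ^ (k * n + tri k)) =
         1 + (\<Sum>k=1..n. (-1) ^ k * (q ^ (k * k + tri (k - 1)) + q ^ (k * k + tri k)))"
proof (induction n)
  case 0
  show ?case by simp
next
  case (Suc n)
  \<comment> \<open>\<open>U\<close> is the certificate of Shanks: \<open>T (Suc n) k - T n k\<close> telescopes in \<open>k\<close>.\<close>
  define T where "T m k = (-1) ^ k * qpoch_ratio q k m * q ^ (k * m + tri k)" for m k
  define U where "U k = (-1) ^ k * qpoch_ratio q k n * q ^ (Suc n + k * Suc n + tri k)" for k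
  have step: "T (Suc n) k = T n k + (if k = 0 then 0 else U (k - 1)) - U k" if "k \<le> n" for k
  proof (cases k)
    case 0
    then show ?thesis
      by (simp add: T_def U_def qpoch_ratio_Suc_right algebra_simps)
  next
    case (Suc j)
    \<comment> \<open>Since \<open>k = Suc j\<close>, the exponent
      \<open>Suc n + j * Suc n + tri j\<close> of \<open>U j\<close> equals
      \<open>k * n + tri k\<close>, the one in \<open>T n k\<close>.\<close>
    have U: "U j = (-1) ^ j * ((1 - q ^ k) * qpoch_ratio q k n) * q ^ (k * n + tri k)"
      using that Suc by (simp add: U_def qpoch_ratio_Suc_left[of j n] algebra_simps)
    have "T (Suc n) k = (-1) ^ k * (qpoch_ratio q k n * (1 - q ^ Suc n)) * (q ^ (k * n + tri k) * q ^ k)"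
      using that by (simp add: T_def qpoch_ratio_Suc_right flip: power_add) (simp add: ac_simps)
    moreover have "U k = (-1) ^ k * qpoch_ratio q k n * (q ^ Suc n * (q ^ (k * n + tri k) * q ^ k))"
      by (simp add: U_def flip: power_add power_Suc) (simp add: ac_simps)
    moreover have "(-1) ^ k = - ((-1) ^ j :: 'a)"
      using Suc by simp
    ultimately show ?thesis
      using Suc U unfolding T_def by (simp add: algebra_simps del: power_Suc)
  qed
  have tel: "(\<Sum>k\<le>m. (if k = 0 then 0 else U (k - 1)) - U k) = - U m" for m
    by (induction m) auto
  \<comment> \<open>The top term and what is left of the telescoping sum, \<open>- U n\<close>, are
    the two new pentagonal terms.\<close>
  have "(\<Sum>k\<le>Suc n. T (Suc n) k) = T (Suc n) (Suc n) + (\<Sum>k\<le>n. T n k) - U n"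
    using tel[of n] by (simp add: step sum.distrib sum_subtractf algebra_simps)
  moreover have "T (Suc n) (Suc n) = (-1) ^ Suc n * q ^ (Suc n * Suc n + tri (Suc n))"
    by (simp add: T_def)
  moreover have "U n = (-1) ^ n * q ^ (Suc n * Suc n + tri n)"
    by (simp add: U_def)
  ultimately show ?case
    using Suc.IH unfolding T_def by (simp add: algebra_simps)
qed

text \<open>The exponents are \<open>k(3k-1)/2\<close> and \<open>k(3k+1)/2\<close>, so the squares
  are those of \<open>6k-1\<close> and \<open>6k+1\<close>.\<close>

lemma pentagonal_squares:
  assumes "1 \<le> k" and "e = k * k + tri (k - 1) \<or> e = k * k + tri k"
  shows "\<exists>y. 24 * e + 1 = y ^ 2"
proof -
  obtain j where k: "k = Suc j"
    using assms(1) by (cases k) auto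
  have "24 * e + 1 = (6 * j + 5) ^ 2 \<or> 24 * e + 1 = (6 * j + 7) ^ 2"
    using assms(2) tri_eq[of j] unfolding k power2_eq_square
    by (auto simp: algebra_simps)
  then show ?thesis by blast
qed

text \<open>Up to degree \<open>n\<close> the left-hand sum of \<open>shanks_pentagonal\<close> at
  \<open>q = X^d\<close> reduces to its term \<open>k = 0\<close>, which is the product; so
  \<open>e\<close> is \<open>d\<close> times a pentagonal number.\<close>

lemma qpoch_X_power_support:
  fixes d n e :: nat
  assumes "0 < d" and "e \<le> n" and "fps_nth (qpoch (fps_X ^ d :: 'a::comm_ring_1 fps) n) e \<noteq> 0"
  shows "\<exists>y. 24 * e + d = d * y ^ 2"
proof -
  let ?q = "fps_X ^ d :: 'a fps"
  define T where "T k = (-1) ^ k * qpoch_ratio ?q k n * ?q ^ (k * n + tri k)" for k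
  have sgn: "(-1) ^ k = fps_const ((-1) ^ k :: 'a)" for k :: nat
    by (metis fps_const_1_eq_1 fps_const_neg fps_const_power)
  have T0: "T 0 = qpoch ?q n"
    by (simp add: T_def qpoch_ratio_0)
  have "fps_nth (T k) e = 0" if "1 \<le> k" for k
  proof -
    have "k * n \<ge> n" and "tri k \<ge> 1"
      using that by (auto simp: Suc_le_eq) (cases k; simp)
    then have "e < k * n + tri k"
      using assms by linarith
    also have "\<dots> \<le> d * (k * n + tri k)"
      using assms(1) by simp
    finally show ?thesis
      unfolding T_def by (simp add: fps_X_power_mult_right_nth flip: power_mult)
  qed
  then have "fps_nth (\<Sum>k\<le>n. T k) e = fps_nth (T 0) e"
    by (simp add: fps_sum_nth sum.atMost_shift)
  then have "fps_nth (\<Sum>k\<le>n. T k) e \<noteq> 0"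
    using assms(3) T0 by simp
  then have "fps_nth (1 + (\<Sum>k=1..n. (-1) ^ k * (?q ^ (k * k + tri (k - 1)) + ?q ^ (k * k + tri k)))) e \<noteq> 0"
    unfolding T_def shanks_pentagonal .
  then have "e = 0 \<or> (\<Sum>k=1..n. fps_nth ((-1) ^ k * (?q ^ (k * k + tri (k - 1)) + ?q ^ (k * k + tri k))) e) \<noteq> 0"
    by (auto simp: fps_sum_nth)
  then have "e = 0 \<or> (\<exists>k\<in>{1..n}. fps_nth ((-1) ^ k * (?q ^ (k * k + tri (k - 1)) + ?q ^ (k * k + tri k))) e \<noteq> 0)"
    by (meson sum.not_neutral_contains_not_neutral)
  then show ?thesis
  proof
    assume "e = 0"
    then show ?thesis by (intro exI[of _ 1]) simp
  next
    assume "\<exists>k\<in>{1..n}. fps_nth ((-1) ^ k * (?q ^ (k * k + tri (k - 1)) + ?q ^ (k * k + tri k))) e \<noteq> 0"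
    then obtain k where k: "1 \<le> k"
      and "fps_nth ((-1) ^ k * (?q ^ (k * k + tri (k - 1)) + ?q ^ (k * k + tri k))) e \<noteq> 0"
      by auto
    then have "e = d * (k * k + tri (k - 1)) \<or> e = d * (k * k + tri k)"
      unfolding sgn by (auto simp: fps_X_power_nth simp flip: power_mult split: if_splits)
    then obtain e' where e': "e = d * e'" "e' = k * k + tri (k - 1) \<or> e' = k * k + tri k"
      by blast
    obtain y where "24 * e' + 1 = y ^ 2"
      using pentagonal_squares[OF k e'(2)] by blast
    then have "24 * e + d = d * y ^ 2"
      unfolding e'(1) by (metis add_mult_distrib2 mult.left_commute mult.right_neutral)
    then show ?thesis ..
  qed
qed

section \<open>Gaussian binomials and Jacobi's identity\<close>

text \<open>Gaussian binomials by the q-Pascal rule, hence without division. The truncated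
  \<open>n - k\<close> is harmless: for \<open>k > n\<close> the factor \<open>qbinom q n k\<close>
  is 0.\<close>

fun qbinom :: "'a::comm_ring_1 \<Rightarrow> nat \<Rightarrow> nat \<Rightarrow> 'a" where
  "qbinom q n 0 = 1"
| "qbinom q 0 (Suc k) = 0"
| "qbinom q (Suc n) (Suc k) = qbinom q n (Suc k) + q ^ (n - k) * qbinom q n k"

lemma qbinom_eq_0: "n < k \<Longrightarrow> qbinom q n k = 0"
  by (induction q n k rule: qbinom.induct) auto

lemma qbinom_mult_qpoch:
  "k \<le> n \<Longrightarrow> qbinom q n k * qpoch q k * qpoch q (n - k) = qpoch q n"
proof (induction q n k rule: qbinom.induct)
  case (3 q n k)
  define r where "r = qpoch q (n - k)"
  have IH2: "qbinom q n k * qpoch q k * r = qpoch q n"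
    using 3 by (simp add: r_def)
  have IH1: "qbinom q n (Suc k) * qpoch q (Suc k) * r = qpoch q n * (1 - q ^ (n - k))"
  proof (cases "k = n")
    case True
    then show ?thesis by (simp add: qbinom_eq_0)
  next
    case False
    then have "n - k = Suc (n - Suc k)" and "Suc k \<le> n"
      using 3(3) by auto
    then have "qbinom q n (Suc k) * qpoch q (Suc k) * r =
        (qbinom q n (Suc k) * qpoch q (Suc k) * qpoch q (n - Suc k)) * (1 - q ^ (n - k))"
      unfolding r_def by (simp only: qpoch_Suc mult.assoc)
    also have "\<dots> = qpoch q n * (1 - q ^ (n - k))"
      using 3(1) \<open>Suc k \<le> n\<close> by simp
    finally show ?thesis .
  qed
  have pow: "q ^ (n - k) * q ^ Suc k = q ^ Suc n"
    using 3(3) by (simp only: flip: power_add) simp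
  have "qbinom q (Suc n) (Suc k) * qpoch q (Suc k) * qpoch q (Suc n - Suc k) =
      qbinom q n (Suc k) * qpoch q (Suc k) * r
      + q ^ (n - k) * (1 - q ^ Suc k) * (qbinom q n k * qpoch q k * r)"
    by (simp add: r_def qpoch_Suc algebra_simps)
  also have "\<dots> = qpoch q n * (1 - q ^ (n - k)) + q ^ (n - k) * (1 - q ^ Suc k) * qpoch q n"
    unfolding IH1 IH2 ..
  also have "\<dots> = qpoch q n * (1 - q ^ (n - k) * q ^ Suc k)"
    by (simp only: algebra_simps mult_1_left mult_1_right)
  also have "\<dots> = qpoch q (Suc n)"
    unfolding pow qpoch_Suc ..
  finally show ?case .
qed auto

text \<open>Rothe's q-binomial theorem. Passing from \<open>n\<close> to \<open>Suc n\<close>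
  multiplies by \<open>y - q^n x\<close>, and comparing coefficients of \<open>x^k\<close> gives the
  q-Pascal rule.\<close>

lemma coeff_qbinomial_prod:
  fixes q y :: "'a::comm_ring_1"
  shows "coeff (\<Prod>i<n. [:y, - (q ^ i):]) k =
    (-1) ^ k * qbinom q n k * q ^ (k choose 2) * y ^ (n - k)"
proof (induction n arbitrary: k)
  case 0
  then show ?case by (cases k) (auto simp: numeral_2_eq_2)
next
  case (Suc n)
  show ?case
  proof (cases k)
    case 0
    then show ?thesis by (simp add: Suc numeral_2_eq_2)
  next
    case k: (Suc j)
    have c: "q ^ n * (qbinom q n j * q ^ (j choose 2)) =
        q ^ (n - j) * qbinom q n j * q ^ (Suc j choose 2)"
    proof (cases "j \<le> n")
      case True
      have "Suc j choose 2 = (j choose 2) + j"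
        by (simp add: numeral_2_eq_2)
      then have "n + (j choose 2) = (n - j) + (Suc j choose 2)"
        using True by simp
      then have "q ^ n * q ^ (j choose 2) = q ^ (n - j) * q ^ (Suc j choose 2)"
        by (simp only: flip: power_add)
      then have "qbinom q n j * (q ^ n * q ^ (j choose 2)) =
          qbinom q n j * (q ^ (n - j) * q ^ (Suc j choose 2))"
        by (rule arg_cong)
      then show ?thesis by (simp only: ac_simps)
    qed (simp add: qbinom_eq_0)
    have d: "y * (qbinom q n (Suc j) * y ^ (n - Suc j)) = qbinom q n (Suc j) * y ^ (n - j)"
    proof (cases "Suc j \<le> n")
      case True
      then have "n - j = Suc (n - Suc j)" by simp
      then show ?thesis by simp
    qed (simp add: qbinom_eq_0)
    have "coeff (\<Prod>i<Suc n. [:y, - (q ^ i):]) k =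
        y * coeff (\<Prod>i<n. [:y, - (q ^ i):]) (Suc j) - q ^ n * coeff (\<Prod>i<n. [:y, - (q ^ i):]) j"
      by (simp add: k mult.commute[of _ "[:y, - (q ^ n):]"])
    also have "\<dots> = (-1) ^ Suc j * q ^ (Suc j choose 2) * (y * (qbinom q n (Suc j) * y ^ (n - Suc j)))
       - q ^ n * (qbinom q n j * q ^ (j choose 2)) * (-1) ^ j * y ^ (n - j)"
      by (simp add: Suc ac_simps)
    also have "\<dots> = (-1) ^ Suc j * (qbinom q n (Suc j) + q ^ (n - j) * qbinom q n j) * q ^ (Suc j choose 2) * y ^ (n - j)"
      unfolding c d by (simp add: algebra_simps)
    finally show ?thesis by (simp add: k)
  qed
qed

lemma poly_pderiv_1:
  fixes p :: "'a::idom poly"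
  assumes "degree p \<le> n"
  shows "poly (pderiv p) 1 = (\<Sum>k\<le>n. of_nat k * coeff p k)"
proof -
  have "p = (\<Sum>k\<le>n. monom (coeff p k) k)"
    using assms by (rule poly_as_sum_of_monoms'[symmetric])
  moreover have "pderiv (\<Sum>k\<le>n. f k) = (\<Sum>k\<le>n. pderiv (f k))" for f :: "nat \<Rightarrow> 'a poly"
    by (induction n) (auto simp: pderiv_add)
  ultimately have "pderiv p = (\<Sum>k\<le>n. pderiv (monom (coeff p k) k))"
    by metis
  then show ?thesis
    by (simp add: poly_sum pderiv_monom poly_monom)
qed

lemma prod_lessThan_odd_split:
  fixes f :: "nat \<Rightarrow> 'a::comm_monoid_mult"
  shows "(\<Prod>i<2 * m + 1. f i) = (\<Prod>i<m. f i) * f m * (\<Prod>i<m. f (m + Suc i))"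
proof -
  have "(\<Prod>i<Suc m + l. f i) = (\<Prod>i<m. f i) * f m * (\<Prod>i<l. f (m + Suc i))" for l
    by (induction l) (auto simp: ac_simps)
  from this[of m] show ?thesis by (simp add: mult_2)
qed

lemma sum_lessThan_choose: "(\<Sum>i<m. i) = m choose 2"
  by (induction m) (auto simp: numeral_2_eq_2)

text \<open>The derivative at \<open>x = 1\<close> of \<open>\<Prod>i\<le>2m. (q^m - x q^i)\<close>, computed from the factors
  and from the expansion in powers of \<open>x\<close>.\<close>

lemma finite_jacobi:
  fixes q :: "'a::idom"
  shows "(\<Sum>k\<le>2 * m + 1. of_nat k * ((-1) ^ k * qbinom q (2 * m + 1) k
            * q ^ (k choose 2) * q ^ (m * (2 * m + 1 - k)))) =
         (-1) ^ Suc m * q ^ ((m choose 2) + m * m + m) * (qpoch q m)\<^sup>2"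
proof -
  define f where "f i = [:q ^ m, - (q ^ i):]" for i
  let ?G = "\<Prod>i<2 * m + 1. f i"
  have "degree ?G \<le> (\<Sum>i<2 * m + 1. degree (f i))"
    by (rule order.trans[OF degree_prod_sum_le]) auto
  also have "\<dots> \<le> (\<Sum>i<2 * m + 1. 1)"
    by (intro sum_mono) (simp add: f_def)
  finally have "degree ?G \<le> 2 * m + 1" by simp
  then have "poly (pderiv ?G) 1 = (\<Sum>k\<le>2 * m + 1. of_nat k * coeff ?G k)"
    by (rule poly_pderiv_1)
  also have "\<dots> = (\<Sum>k\<le>2 * m + 1. of_nat k * ((-1) ^ k * qbinom q (2 * m + 1) k
            * q ^ (k choose 2) * q ^ (m * (2 * m + 1 - k))))"
    unfolding f_def coeff_qbinomial_prod by (simp only: power_mult)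
  finally have expansion: "poly (pderiv ?G) 1 = \<dots>" .
  have low: "poly (\<Prod>i<m. f i) 1 = (-1) ^ m * q ^ (m choose 2) * qpoch q m"
  proof -
    have "poly (\<Prod>i<m. f i) 1 = (\<Prod>i<m. q ^ m - q ^ i)"
      by (simp add: poly_prod f_def)
    also have "\<dots> = (\<Prod>i<m. (-1) * (q ^ i * (1 - q ^ (m - i))))"
      by (intro prod.cong) (auto simp: algebra_simps simp flip: power_add)
    also have "\<dots> = (-1) ^ m * (q ^ (\<Sum>i<m. i) * (\<Prod>i<m. 1 - q ^ (m - i)))"
      by (simp only: prod.distrib power_sum) simp
    also have "(\<Prod>i<m. 1 - q ^ (m - i)) = qpoch q m"
      unfolding qpoch_def by (subst prod.nat_diff_reindex[symmetric]) (auto intro!: prod.cong simp: Suc_diff_Suc)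
    finally show ?thesis
      by (simp add: sum_lessThan_choose ac_simps)
  qed
  have high: "poly (\<Prod>i<m. f (m + Suc i)) 1 = q ^ (m * m) * qpoch q m"
  proof -
    have "poly (\<Prod>i<m. f (m + Suc i)) 1 = (\<Prod>i<m. q ^ m * (1 - q ^ Suc i))"
      unfolding poly_prod f_def by (intro prod.cong) (auto simp: algebra_simps power_add)
    then show ?thesis
      by (simp add: prod.distrib qpoch_def power_mult)
  qed
  \<comment> \<open>The factor \<open>f m\<close> vanishes at 1, so the product rule leaves only the
    term in which it is differentiated.\<close>
  have "?G = f m * ((\<Prod>i<m. f i) * (\<Prod>i<m. f (m + Suc i)))"
    unfolding prod_lessThan_odd_split by (simp only: ac_simps)
  moreover have "poly (f m) 1 = 0" and "poly (pderiv (f m)) 1 = - (q ^ m)"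
    by (simp_all add: f_def pderiv_pCons)
  ultimately have "poly (pderiv ?G) 1 = - (q ^ m) * (poly (\<Prod>i<m. f i) 1 * poly (\<Prod>i<m. f (m + Suc i)) 1)"
    by (simp add: pderiv_mult)
  then show ?thesis
    unfolding expansion low high by (simp add: power_add power2_eq_square ac_simps)
qed

section \<open>Generating functions of partitions\<close>

definition partition_fps :: "nat set \<Rightarrow> int fps" where
  "partition_fps A = Abs_fps (\<lambda>n. int (card {M. set_mset M \<subseteq> A \<and> sum_mset M = n}))"

lemma finite_partitions_parts:
  fixes A :: "nat set"
  assumes "0 \<notin> A"
  shows "finite {M. set_mset M \<subseteq> A \<and> sum_mset M = n}"
  using assms
  by (intro finite_subset[OF _ finite_partitions_le[of n]]) (auto simp: is_partition_def intro!: gr0I)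

text \<open>Deleting one copy of \<open>a\<close> matches the partitions of \<open>n\<close> that
  contain \<open>a\<close> with all partitions of \<open>n - a\<close> into parts from
  \<open>insert a A\<close>.\<close>

lemma partition_fps_insert:
  assumes "a \<notin> A" and "0 < a" and "0 \<notin> A"
  shows "partition_fps (insert a A) * (1 - fps_X ^ a) = partition_fps A"
proof (rule fps_ext)
  fix n
  let ?S = "\<lambda>B n. {M. set_mset M \<subseteq> B \<and> sum_mset M = n}"
  have fin: "finite (?S (insert a A) n)" for n
    using assms by (intro finite_partitions_parts) auto
  have split: "?S (insert a A) n = ?S A n \<union> {M \<in> ?S (insert a A) n. a \<in># M}"
    by auto
  have disj: "?S A n \<inter> {M \<in> ?S (insert a A) n. a \<in># M} = {}"
    using assms(1) by auto
  have card: "card (?S (insert a A) n) = card (?S A n) + card {M \<in> ?S (insert a A) n. a \<in># M}"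
    by (subst split, rule card_Un_disjoint)
       (use fin[of n] disj finite_partitions_parts[OF assms(3)] in \<open>auto intro: rev_finite_subset\<close>)
  have with_a: "card {M \<in> ?S (insert a A) n. a \<in># M} =
      (if n < a then 0 else card (?S (insert a A) (n - a)))"
  proof (cases "n < a")
    case True
    have "{M \<in> ?S (insert a A) n. a \<in># M} = {}"
      using True by (auto dest!: multi_member_split)
    then show ?thesis
      using True by (simp only: card.empty if_True)
  next
    case False
    have "bij_betw (add_mset a) (?S (insert a A) (n - a)) {M \<in> ?S (insert a A) n. a \<in># M}"
      using False
      by (intro bij_betw_byWitness[where f' = "\<lambda>M. M - {#a#}"])
         (auto dest: in_diffD simp: sum_mset_diff)
    then show ?thesis
      using False by (simp add: bij_betw_same_card)
  qed
  show "fps_nth (partition_fps (insert a A) * (1 - fps_X ^ a)) n = fps_nth (partition_fps A) n"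
    using card with_a
    by (simp add: partition_fps_def right_diff_distrib fps_X_power_mult_right_nth)
qed

lemma partition_fps_prod:
  assumes "finite A" and "0 \<notin> A"
  shows "partition_fps A * (\<Prod>a\<in>A. 1 - fps_X ^ a) = 1"
  using assms
proof (induction A rule: finite_induct)
  case empty
  have "{M. set_mset M \<subseteq> {} \<and> sum_mset M = n} = (if n = 0 then {{#}} else {})" for n :: nat
    by auto
  then show ?case
    by (intro fps_ext) (simp add: partition_fps_def)
next
  case (insert a A)
  then have "0 < a" by (auto intro: gr0I)
  with insert show ?case
    by (simp add: partition_fps_insert flip: mult.assoc)
qed

text \<open>No part exceeds the sum, so bounding the parts by \<open>N\<close> loses nothing; the
  square convolves over the size of the first partition.\<close>

lemma B5_eq_coeff:
  assumes "n \<le> N"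
  shows "int (B5 n) = fps_nth ((partition_fps {k\<in>{1..N}. \<not> 5 dvd k})\<^sup>2) n"
proof -
  let ?A = "{k\<in>{1..N}. \<not> 5 dvd k}"
  let ?S = "\<lambda>i. {M. set_mset M \<subseteq> ?A \<and> sum_mset M = i}"
  have reg: "set_mset M \<subseteq> ?A \<longleftrightarrow> regular_partition 5 M" if "sum_mset M \<le> N" for M
  proof -
    have "x \<le> N" if "x \<in># M" for x
      using \<open>sum_mset M \<le> N\<close> that by (auto dest!: multi_member_split)
    then show ?thesis
      by (auto simp: regular_partition_def is_partition_def Suc_le_eq)
  qed
  have "bipartitions5 n = (\<Union>i\<in>{0..n}. ?S i \<times> ?S (n - i))"
  proof (intro equalityI subsetI)
    fix z assume "z \<in> bipartitions5 n"
    then obtain M M' where "z = (M, M')" "regular_partition 5 M" "regular_partition 5 M'"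
      "sum_mset M + sum_mset M' = n"
      unfolding bipartitions5_def by blast
    then show "z \<in> (\<Union>i\<in>{0..n}. ?S i \<times> ?S (n - i))"
      using assms reg[of M] reg[of M'] by (auto intro!: bexI[of _ "sum_mset M"])
  next
    fix z assume "z \<in> (\<Union>i\<in>{0..n}. ?S i \<times> ?S (n - i))"
    then obtain M M' i where "z = (M, M')" "i \<le> n" "M \<in> ?S i" "M' \<in> ?S (n - i)"
      by auto
    then show "z \<in> bipartitions5 n"
      using assms reg[of M] reg[of M'] unfolding bipartitions5_def by simp
  qed
  then have "B5 n = card (\<Union>i\<in>{0..n}. ?S i \<times> ?S (n - i))"
    by (simp add: B5_def)
  also have "\<dots> = (\<Sum>i=0..n. card (?S i \<times> ?S (n - i)))"
  proof (rule card_UN_disjoint)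
    show "\<forall>i\<in>{0..n}. finite (?S i \<times> ?S (n - i))"
      by (intro ballI finite_cartesian_product finite_partitions_parts) auto
  qed auto
  finally show ?thesis
    by (simp add: partition_fps_def power2_eq_square fps_mult_nth card_cartesian_product)
qed

section \<open>Triangular numbers and the cube of Euler's product\<close>

lemma fps_X_power_dvd_nth:
  fixes f :: "'a::comm_ring_1 fps"
  assumes "fps_X ^ N dvd f" and "n < N"
  shows "fps_nth f n = 0"
  using assms by (auto elim!: dvdE simp: fps_X_power_mult_nth)

text \<open>A factor \<open>1 - X^i\<close> with \<open>i > j\<close> alters only coefficients
  beyond \<open>X^j\<close>.\<close>

lemma qpoch_X_diff:
  "j \<le> m \<Longrightarrow> fps_X ^ Suc j dvd qpoch fps_X m - qpoch (fps_X :: 'a::comm_ring_1 fps) j"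
proof (induction m rule: dec_induct)
  case (step m)
  have "qpoch fps_X (Suc m) - qpoch (fps_X :: 'a fps) j =
      (qpoch fps_X m - qpoch fps_X j) - fps_X ^ Suc m * qpoch fps_X m"
    unfolding qpoch_Suc by (simp add: algebra_simps del: power_Suc)
  moreover have "fps_X ^ Suc j dvd (fps_X :: 'a fps) ^ Suc m * qpoch fps_X m"
    using step(1) by (intro dvd_mult2 le_imp_power_dvd) simp
  ultimately show ?case
    using step.IH by (metis dvd_diff)
qed simp

text \<open>The inverse counts partitions into parts at most \<open>m\<close>, so its coefficients
  are integers.\<close>

lemma qpoch_X_unit:
  obtains u :: "int fps" where "qpoch fps_X m * u = 1"
proof
  show "qpoch fps_X m * partition_fps {1..m} = 1"
    by (simp add: qpoch_eq_prod partition_fps_prod mult.commute)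
qed

text \<open>Modulo \<open>X^(K+1)\<close> every \<open>qpoch\<close> of index at least
  \<open>K\<close> is the same series \<open>E\<close>, so \<open>qbinom_mult_qpoch\<close> reads
  \<open>B E^2 = E\<close>, and the unit \<open>E\<close> cancels.\<close>

lemma qbinom_mult_qpoch_X:
  assumes "K \<le> k" and "K \<le> N - k" and "K \<le> m" and "k \<le> N"
  shows "fps_X ^ Suc K dvd qbinom (fps_X :: int fps) N k * qpoch fps_X m - 1"
proof -
  let ?E = "\<lambda>j. qpoch (fps_X :: int fps) j"
  let ?B = "qbinom (fps_X :: int fps) N k"
  obtain u where u: "?E m * u = 1"
    by (rule qpoch_X_unit)
  have near: "fps_X ^ Suc K dvd ?E m - ?E j" if "K \<le> j" for j
    using dvd_diff[OF qpoch_X_diff[OF assms(3)] qpoch_X_diff[OF that]] by simp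
  have "?B * ?E k * ?E (N - k) = ?E N"
    using assms(4) by (rule qbinom_mult_qpoch)
  then have "?E m * (?B * ?E m - 1) =
      ?B * (?E m * (?E m - ?E (N - k)) + ?E (N - k) * (?E m - ?E k)) - (?E m - ?E N)"
    by (simp add: algebra_simps)
  also have "fps_X ^ Suc K dvd \<dots>"
    using assms by (intro dvd_diff dvd_mult dvd_add near) auto
  finally have "fps_X ^ Suc K dvd (?E m * (?B * ?E m - 1)) * u"
    by (rule dvd_mult2)
  also have "(?E m * (?B * ?E m - 1)) * u = (?E m * u) * (?B * ?E m - 1)"
    by (simp only: ac_simps)
  finally show ?thesis
    unfolding u by simp
qed

text \<open>Factoring out the power of \<open>q\<close> on the right of \<open>finite_jacobi\<close>
  leaves triangular exponents; \<open>k\<close> and \<open>2 * m + 1 - k\<close> share the same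
  one.\<close>

lemma jacobi_exponent:
  assumes "k \<le> 2 * m + 1"
  shows "(k choose 2) + m * (2 * m + 1 - k) =
    (m choose 2) + m * m + m + tri (if k \<le> m then m - k else k - m - 1)"
proof -
  have ch: "2 * (x choose 2) + x = x * x" for x :: nat
    by (induction x) (auto simp: numeral_2_eq_2)
  show ?thesis
  proof (cases "k \<le> m")
    case True
    then obtain l where "m = k + l" by (auto simp: le_iff_add)
    then show ?thesis
      using ch[of k] ch[of m] tri_eq[of l] by (simp add: algebra_simps)
  next
    case False
    then obtain l where l: "k = m + 1 + l"
      by (metis Suc_eq_plus1 add_Suc_shift less_iff_Suc_add not_le add.assoc)
    obtain d where d: "m = l + d"
      using assms l by (auto simp: le_iff_add)
    show ?thesis
      using ch[of k] ch[of m] tri_eq[of l] l d by (simp add: algebra_simps)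
  qed
qed

lemma qpoch_X_cube_support:
  assumes "n \<le> m" and "fps_nth (qpoch (fps_X :: int fps) m ^ 3) n \<noteq> 0"
  shows "\<exists>z. 8 * n + 1 = z\<^sup>2"
proof -
  let ?E = "qpoch (fps_X :: int fps) m"
  let ?B = "\<lambda>k. qbinom (fps_X :: int fps) (2 * m + 1) k"
  define c where "c = (m choose 2) + m * m + m"
  define l where "l k = (if k \<le> m then m - k else k - m - 1)" for k
  define s where "s k = int k * (-1) ^ k" for k
  have const: "of_nat k * (-1) ^ k = fps_const (s k)" for k
    unfolding s_def
    by (metis fps_const_1_eq_1 fps_const_mult fps_const_neg fps_const_power fps_of_nat)
  \<comment> \<open>One more factor \<open>?E\<close> turns the square in
    \<open>finite_jacobi\<close> into a cube and each Gaussian binomial into a series close to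
    1.\<close>
  have "fps_X ^ c * ((-1) ^ Suc m * ?E ^ 3) = ((-1) ^ Suc m * fps_X ^ c * ?E\<^sup>2) * ?E"
    by (simp add: power2_eq_square power3_eq_cube ac_simps)
  also have "\<dots> = (\<Sum>k\<le>2 * m + 1. (of_nat k * ((-1) ^ k * ?B k
            * fps_X ^ (k choose 2) * fps_X ^ (m * (2 * m + 1 - k)))) * ?E)"
    unfolding c_def by (simp only: finite_jacobi[symmetric] sum_distrib_right)
  also have "\<dots> = (\<Sum>k\<le>2 * m + 1. fps_X ^ c * ((of_nat k * (-1) ^ k) * (fps_X ^ tri (l k) * (?B k * ?E))))"
  proof (rule sum.cong)
    fix k assume "k \<in> {..2 * m + 1}"
    then have "(fps_X :: int fps) ^ (k choose 2) * fps_X ^ (m * (2 * m + 1 - k)) = fps_X ^ c * fps_X ^ tri (l k)"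
      using jacobi_exponent[of k m] by (simp only: flip: power_add) (simp add: c_def l_def)
    moreover have "(of_nat k * ((-1) ^ k * ?B k * fps_X ^ (k choose 2) * fps_X ^ (m * (2 * m + 1 - k)))) * ?E =
       of_nat k * (-1) ^ k * (?B k * ?E) * (fps_X ^ (k choose 2) * fps_X ^ (m * (2 * m + 1 - k)))"
      by (simp only: ac_simps)
    ultimately show "(of_nat k * ((-1) ^ k * ?B k * fps_X ^ (k choose 2) * fps_X ^ (m * (2 * m + 1 - k)))) * ?E =
        fps_X ^ c * ((of_nat k * (-1) ^ k) * (fps_X ^ tri (l k) * (?B k * ?E)))"
      by (simp only: ac_simps)
  qed simp
  also have "\<dots> = fps_X ^ c * (\<Sum>k\<le>2 * m + 1. fps_const (s k) * (fps_X ^ tri (l k) * (?B k * ?E)))"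
    by (simp only: sum_distrib_left const)
  finally have cube: "(-1) ^ Suc m * ?E ^ 3 =
      (\<Sum>k\<le>2 * m + 1. fps_const (s k) * (fps_X ^ tri (l k) * (?B k * ?E)))"
    by (rule mult_left_cancel[THEN iffD1, rotated]) simp
  \<comment> \<open>The product \<open>?B k * ?E\<close> is 1 up to degree \<open>m - l k\<close>,
    the minimum of \<open>k\<close> and \<open>2 * m + 1 - k\<close>. The shift by
    \<open>tri (l k) \<ge> l k\<close> extends this to degree \<open>m\<close>.\<close>
  have nth: "fps_nth (fps_X ^ tri (l k) * (?B k * ?E)) n = (if n = tri (l k) then 1 else 0)"
    if "k \<le> 2 * m + 1" for k
  proof -
    have le: "l k \<le> tri (l k)"
      by (cases "l k") auto
    have "fps_X ^ Suc (m - l k) dvd ?B k * ?E - 1"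
      using that by (intro qbinom_mult_qpoch_X) (auto simp: l_def)
    then have "fps_X ^ (tri (l k) + Suc (m - l k)) dvd fps_X ^ tri (l k) * (?B k * ?E - 1)"
      unfolding power_add by (rule mult_dvd_mono[OF dvd_refl])
    then have "fps_nth (fps_X ^ tri (l k) * (?B k * ?E - 1)) n = 0"
      by (rule fps_X_power_dvd_nth) (use le assms(1) in linarith)
    then show ?thesis
      by (simp add: right_diff_distrib fps_X_power_nth)
  qed
  have "fps_nth ((-1) ^ Suc m * ?E ^ 3) n \<noteq> 0"
    using assms(2) by (cases "even m") auto
  then obtain k where "k \<le> 2 * m + 1"
    and "s k * fps_nth (fps_X ^ tri (l k) * (?B k * ?E)) n \<noteq> 0"
    unfolding cube fps_sum_nth fps_mult_left_const_nth
    by (metis (no_types, lifting) atMost_iff sum.not_neutral_contains_not_neutral)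
  then have "n = tri (l k)"
    using nth by (simp split: if_splits)
  then have "8 * n + 1 = (2 * l k + 1)\<^sup>2"
    using tri_eq[of "l k"] by (simp add: power2_eq_square algebra_simps)
  then show ?thesis ..
qed

section \<open>Reduction modulo 5\<close>

text \<open>Factor by factor this is the congruence of \<open>(1 - x)^5\<close> and
  \<open>1 - x^5\<close> modulo 5.\<close>

lemma qpoch_frobenius_5:
  "(5 :: 'a::comm_ring_1) dvd qpoch (q ^ 5) n - qpoch q n ^ 5"
proof (induction n)
  case (Suc n)
  define x where "x = q ^ Suc n"
  have x5: "(q ^ 5) ^ Suc n = x ^ 5"
    unfolding x_def by (simp only: mult.commute flip: power_mult)
  have "1 - x ^ 5 - (1 - x) ^ 5 = 5 * (x - 2 * x\<^sup>2 + 2 * x ^ 3 - x ^ 4)"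
    by (simp add: eval_nat_numeral algebra_simps)
  then have "5 dvd 1 - x ^ 5 - (1 - x) ^ 5"
    by (rule dvdI)
  then have "5 dvd (qpoch (q ^ 5) n - qpoch q n ^ 5) * (1 - x ^ 5)
      + qpoch q n ^ 5 * (1 - x ^ 5 - (1 - x) ^ 5)"
    using Suc by (intro dvd_add dvd_mult dvd_mult2)
  also have "\<dots> = qpoch (q ^ 5) (Suc n) - qpoch q (Suc n) ^ 5"
    unfolding qpoch_Suc x5 power_mult_distrib by (simp add: x_def algebra_simps)
  finally show ?case .
qed simp

text \<open>The cutoff \<open>5 * m\<close> makes the multiples of 5 supply exactly the
  \<open>m\<close> factors of \<open>qpoch (fps_X ^ 5) m\<close>.\<close>

lemma qpoch_split_5:
  "qpoch (fps_X :: int fps) (5 * m) =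
   (\<Prod>a | a \<in> {1..5 * m} \<and> \<not> 5 dvd a. 1 - fps_X ^ a) * qpoch (fps_X ^ 5) m"
proof -
  let ?f = "\<lambda>a. 1 - (fps_X :: int fps) ^ a"
  have "qpoch (fps_X :: int fps) (5 * m) = (\<Prod>a\<in>{1..5 * m}. ?f a)"
    by (rule qpoch_eq_prod)
  also have "\<dots> = (\<Prod>a\<in>{a \<in> {1..5 * m}. \<not> 5 dvd a} \<union> {a \<in> {1..5 * m}. 5 dvd a}. ?f a)"
    by (rule prod.cong) auto
  also have "\<dots> = (\<Prod>a | a \<in> {1..5 * m} \<and> \<not> 5 dvd a. ?f a) * (\<Prod>a\<in>{a \<in> {1..5 * m}. 5 dvd a}. ?f a)"
    by (rule prod.union_disjoint) auto
  also have "(\<Prod>a\<in>{a \<in> {1..5 * m}. 5 dvd a}. ?f a) = qpoch (fps_X ^ 5) m"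
    unfolding qpoch_def
    by (rule prod.reindex_bij_witness[of _ "\<lambda>i. 5 * Suc i" "\<lambda>a. a div 5 - 1"])
       (auto simp flip: power_mult simp del: power_Suc mult_Suc_right)
  finally show ?thesis .
qed

text \<open>Up to degree \<open>m\<close> the series \<open>P\<close> is \<open>F / E\<close>, and
  \<open>F\<close> is congruent to \<open>E^5\<close> modulo 5; so \<open>P^2 = F^2 / E^2\<close> is
  congruent to \<open>F E^3\<close>.\<close>

lemma B5_cong_coeff:
  assumes "n \<le> m"
  shows "5 dvd int (B5 n) - fps_nth (qpoch (fps_X ^ 5) m * qpoch fps_X m ^ 3) n"
proof -
  let ?A = "{a \<in> {1..5 * m}. \<not> 5 dvd a}"
  let ?E = "qpoch (fps_X :: int fps)"
  define P where "P = partition_fps ?A"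
  define F where "F = qpoch (fps_X ^ 5 :: int fps) m"
  have "P * ?E (5 * m) = (P * (\<Prod>a\<in>?A. 1 - fps_X ^ a)) * F"
    unfolding qpoch_split_5 F_def by (simp only: mult.assoc)
  also have "P * (\<Prod>a\<in>?A. 1 - fps_X ^ a) = 1"
    unfolding P_def by (rule partition_fps_prod) auto
  finally have PE: "P * ?E (5 * m) = F" by simp
  obtain u where u: "?E m * u = 1"
    by (rule qpoch_X_unit)
  obtain g where g: "F - ?E m ^ 5 = 5 * g"
    using qpoch_frobenius_5[of fps_X m] unfolding F_def by (rule dvdE)
  obtain r where r: "?E (5 * m) - ?E m = fps_X ^ Suc m * r"
    using qpoch_X_diff[of m "5 * m"] by (auto elim: dvdE)
  have "P\<^sup>2 * (?E m)\<^sup>2 - F * ?E m ^ 5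
      = F * (F - ?E m ^ 5) - P\<^sup>2 * (?E (5 * m) + ?E m) * (?E (5 * m) - ?E m)"
    unfolding PE[symmetric] by (simp add: power2_eq_square algebra_simps)
  also have "\<dots> = 5 * (F * g) - fps_X ^ Suc m * (P\<^sup>2 * (?E (5 * m) + ?E m) * r)"
    unfolding g r by (simp only: ac_simps)
  \<comment> \<open>Multiplying by \<open>u\<^sup>2\<close> amounts to dividing by
    \<open>(?E m)\<^sup>2\<close>.\<close>
  finally have "(P\<^sup>2 * (?E m)\<^sup>2 - F * ?E m ^ 5) * u\<^sup>2 =
      5 * (F * g * u\<^sup>2) - fps_X ^ Suc m * (P\<^sup>2 * (?E (5 * m) + ?E m) * r * u\<^sup>2)"
    by (simp only: left_diff_distrib mult.assoc)
  moreover have "(P\<^sup>2 * (?E m)\<^sup>2 - F * ?E m ^ 5) * u\<^sup>2 = P\<^sup>2 - F * ?E m ^ 3"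
  proof -
    have "(P\<^sup>2 * (?E m)\<^sup>2 - F * ?E m ^ 5) * u\<^sup>2 = (P\<^sup>2 - F * ?E m ^ 3) * (?E m * u)\<^sup>2"
      by (simp add: eval_nat_numeral algebra_simps)
    then show ?thesis unfolding u by simp
  qed
  ultimately have "P\<^sup>2 - F * ?E m ^ 3 =
      5 * (F * g * u\<^sup>2) - fps_X ^ Suc m * (P\<^sup>2 * (?E (5 * m) + ?E m) * r * u\<^sup>2)"
    by simp
  then have "fps_nth (P\<^sup>2 - F * ?E m ^ 3) n = 5 * fps_nth (F * g * u\<^sup>2) n"
    using assms by (simp only: fps_sub_nth fps_X_power_mult_nth numeral_fps_const fps_mult_left_const_nth) simp
  moreover have "int (B5 n) = fps_nth (P\<^sup>2) n"
    unfolding P_def using assms by (intro B5_eq_coeff) simp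
  ultimately show ?thesis
    unfolding F_def by simp
qed

text \<open>Some \<open>i\<close> and \<open>n - i\<close> carry nonzero coefficients of the two
  factors, and \<open>24n + 8 = (24i + 5) + 3(8(n-i) + 1)\<close>.\<close>

lemma B5_support:
  assumes "\<not> 5 dvd B5 n"
  shows "\<exists>y z. 24 * n + 8 = 5 * y\<^sup>2 + 3 * z\<^sup>2"
proof -
  let ?F = "qpoch (fps_X ^ 5 :: int fps) n" and ?E = "qpoch (fps_X :: int fps) n"
  have "\<not> 5 dvd int (B5 n)"
    using assms by presburger
  then have "fps_nth (?F * ?E ^ 3) n \<noteq> 0"
    using B5_cong_coeff[of n n] by auto
  then obtain i where "i \<le> n" and "fps_nth ?F i \<noteq> 0" and "fps_nth (?E ^ 3) (n - i) \<noteq> 0"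
    unfolding fps_mult_nth by (auto elim!: sum.not_neutral_contains_not_neutral)
  then obtain y z where y: "24 * i + 5 = 5 * y\<^sup>2" and z: "8 * (n - i) + 1 = z\<^sup>2"
    using qpoch_X_power_support[of 5 i n] qpoch_X_cube_support[of "n - i" n] by auto
  have "24 * n + 8 = 5 * y\<^sup>2 + 3 * z\<^sup>2"
    unfolding y[symmetric] z[symmetric] using \<open>i \<le> n\<close> by simp
  then show ?thesis by blast
qed

section \<open>Inert primes\<close>

text \<open>Otherwise \<open>p\<close> divides neither variable. Raising the congruence of
  \<open>a y^2\<close> and \<open>-b z^2\<close> to the power \<open>(p-1)/2\<close> removes the
  squares by Fermat and contradicts \<open>nonres\<close>, which by Euler's criterion says that
  \<open>-ab\<close> is a non-residue.\<close>

lemma prime_dvd_quadratic_form: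
  fixes p :: nat and a b y z :: int
  assumes p: "prime p" and a: "\<not> int p dvd a" and b: "\<not> int p dvd b"
    and nonres: "\<not> [a ^ ((p - 1) div 2) = (- b) ^ ((p - 1) div 2)] (mod int p)"
    and dvd: "int p dvd a * y\<^sup>2 + b * z\<^sup>2"
  shows "int p dvd y \<and> int p dvd z"
proof (rule ccontr)
  assume not_both: "\<not> (int p dvd y \<and> int p dvd z)"
  let ?h = "(p - 1) div 2"
  have prime: "prime (int p)" using p by simp
  \<comment> \<open>For \<open>p = 2\<close> the exponent is 0 and both powers in
    \<open>nonres\<close> are 1.\<close>
  have "odd p"
  proof (rule ccontr)
    assume "\<not> odd p"
    then have "p = 2"
      using p primes_dvd_imp_eq two_is_prime_nat by blast
    with nonres show False by simp
  qed
  then have h: "2 * ?h = p - 1" by simp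
  have "int p dvd y \<longleftrightarrow> int p dvd a * y\<^sup>2"
    using a prime by (simp add: prime_dvd_mult_iff prime_dvd_power_iff)
  also have "\<dots> \<longleftrightarrow> int p dvd b * z\<^sup>2"
    using dvd by (metis dvd_add_right_iff dvd_add_left_iff)
  also have "\<dots> \<longleftrightarrow> int p dvd z"
    using b prime by (simp add: prime_dvd_mult_iff prime_dvd_power_iff)
  finally have not_dvd: "\<not> int p dvd y" "\<not> int p dvd z"
    using not_both by blast+
  have fermat: "[(x\<^sup>2) ^ ?h = 1] (mod int p)" if "\<not> int p dvd x" for x
  proof -
    have "coprime x (int p)"
      using prime_imp_coprime[OF prime that] by (simp add: coprime_commute)
    moreover have "residues (int p)"
      using prime_gt_1_nat[OF p] by (simp add: residues_def)
    ultimately have "[x ^ totient (nat (int p)) = 1] (mod int p)"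
      by (rule residues.euler_theorem[rotated])
    then show ?thesis
      using p h by (simp add: totient_prime flip: power_mult)
  qed
  have "[a * y\<^sup>2 = - b * z\<^sup>2] (mod int p)"
    using dvd by (simp add: cong_iff_dvd_diff)
  then have "[(a * y\<^sup>2) ^ ?h = (- b * z\<^sup>2) ^ ?h] (mod int p)"
    by (rule cong_pow)
  then have "[a ^ ?h * (y\<^sup>2) ^ ?h = (- b) ^ ?h * (z\<^sup>2) ^ ?h] (mod int p)"
    by (simp only: power_mult_distrib)
  then have "[a ^ ?h = (- b) ^ ?h] (mod int p)"
    using fermat[OF not_dvd(1)] fermat[OF not_dvd(2)]
    by (metis (no_types, lifting) cong_scalar_left cong_sym cong_trans mult.right_neutral)
  with nonres show False ..
qed

text \<open>Descent: \<open>p\<close> divides \<open>y\<close> and \<open>z\<close>, and dividing by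
  \<open>p^2\<close> lowers the exponent by 2. At exponent 1 the left side still has the factor
  \<open>p^2\<close>, so \<open>p\<close> divides \<open>c\<close>.\<close>

lemma prime_odd_power_quadratic_form:
  fixes p :: nat and a b y z c :: int
  assumes p: "prime p" and a: "\<not> int p dvd a" and b: "\<not> int p dvd b"
    and nonres: "\<not> [a ^ ((p - 1) div 2) = (- b) ^ ((p - 1) div 2)] (mod int p)"
    and eq: "a * y\<^sup>2 + b * z\<^sup>2 = int p ^ (2 * k + 1) * c"
  shows "int p dvd c"
  using eq
proof (induction k arbitrary: y z)
  case (0 y z)
  have "int p dvd a * y\<^sup>2 + b * z\<^sup>2"
    unfolding 0 by simp
  then have "int p dvd y \<and> int p dvd z"
    by (rule prime_dvd_quadratic_form[OF p a b nonres])
  then obtain y' z' where "y = int p * y'" "z = int p * z'"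
    by (auto elim!: dvdE)
  with 0 have "int p * (int p * (a * y'\<^sup>2 + b * z'\<^sup>2)) = int p * c"
    by (simp add: power2_eq_square algebra_simps)
  then have "int p * (a * y'\<^sup>2 + b * z'\<^sup>2) = c"
    using prime_gt_0_nat[OF p] by simp
  then show ?case by (metis dvd_triv_left)
next
  case (Suc k y z)
  have "int p dvd a * y\<^sup>2 + b * z\<^sup>2"
    unfolding Suc.prems by simp
  then have "int p dvd y \<and> int p dvd z"
    by (rule prime_dvd_quadratic_form[OF p a b nonres])
  then obtain y' z' where "y = int p * y'" "z = int p * z'"
    by (auto elim!: dvdE)
  with Suc.prems have "(int p)\<^sup>2 * (a * y'\<^sup>2 + b * z'\<^sup>2) = (int p)\<^sup>2 * (int p ^ (2 * k + 1) * c)"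
    by (simp add: power2_eq_square algebra_simps)
  then have "a * y'\<^sup>2 + b * z'\<^sup>2 = int p ^ (2 * k + 1) * c"
    using prime_gt_0_nat[OF p] by simp
  then show ?case by (rule Suc.IH)
qed

text \<open>The last claim makes \<open>-15\<close> a non-residue modulo \<open>p\<close>; it is
  checked by evaluating powers with exponents 51, 78 and 96.\<close>

lemma inert_primes:
  fixes p :: nat
  assumes "p \<in> {103, 157, 193}"
  shows "prime p" and "p mod 3 = 1" and "\<not> int p dvd 5" and "\<not> int p dvd 3" and "\<not> int p dvd 8"
    and "\<not> [5 ^ ((p - 1) div 2) = (- 3) ^ ((p - 1) div 2)] (mod int p)"
proof -
  show "prime p" using assms by auto
  show "p mod 3 = 1" "\<not> int p dvd 5" "\<not> int p dvd 3" "\<not> int p dvd 8" using assms by auto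
  show "\<not> [5 ^ ((p - 1) div 2) = (- 3) ^ ((p - 1) div 2)] (mod int p)"
    using assms by (auto simp: cong_def)
qed

theorem corollary1p11:
  fixes p n k :: nat
  assumes "p \<in> {103, 157, 193}"
    and "\<not> p dvd (3 * n + 1)"
  shows "[B5 (p ^ (2 * k + 1) * n + (p ^ (2 * k + 1) - 1) div 3) = 0] (mod 5)"
proof (rule ccontr)
  note inert = inert_primes[OF assms(1)]
  let ?P = "p ^ (2 * k + 1)"
  define N where "N = ?P * n + (?P - 1) div 3"
  assume "\<not> [B5 (?P * n + (?P - 1) div 3) = 0] (mod 5)"
  then have "\<not> 5 dvd B5 N"
    by (simp add: N_def cong_0_iff)
  then obtain y z where yz: "24 * N + 8 = 5 * y\<^sup>2 + 3 * z\<^sup>2"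
    using B5_support by blast
  \<comment> \<open>As \<open>p\<close> is 1 modulo 3, so are its powers, and the truncating
    \<open>div\<close> by 3 is exact.\<close>
  have "?P mod 3 = 1"
    using inert(2) by (metis power_mod power_one mod_less one_less_numeral_iff semiring_norm(77))
  then have "3 * ((?P - 1) div 3) + 1 = ?P"
    by presburger
  then have "3 * N + 1 = ?P * (3 * n + 1)"
    unfolding N_def by (simp add: algebra_simps)
  then have "24 * N + 8 = ?P * (8 * (3 * n + 1))"
    by (simp add: algebra_simps)
  then have "5 * y\<^sup>2 + 3 * z\<^sup>2 = ?P * (8 * (3 * n + 1))"
    unfolding yz .
  then have "int (5 * y\<^sup>2 + 3 * z\<^sup>2) = int (?P * (8 * (3 * n + 1)))"
    by (rule arg_cong)
  then have "5 * (int y)\<^sup>2 + 3 * (int z)\<^sup>2 = int p ^ (2 * k + 1) * (8 * int (3 * n + 1))"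
    by (simp only: of_nat_add of_nat_mult of_nat_power of_nat_numeral)
  then have "int p dvd 8 * int (3 * n + 1)"
    by (rule prime_odd_power_quadratic_form[OF inert(1,3,4,6)])
  then have "int p dvd int (3 * n + 1)"
    using inert(1,5) prime_dvd_mult_iff[of "int p"] by (simp only: prime_nat_int_transfer) blast
  with assms(2) show False
    by (simp only: int_dvd_int_iff)
qed

end
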